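(* Let $T:[0,1]\to\mathbb{R}$ be the Takagi function and, for $y\in[0,\frac23]$, let $L(y)=\{x\in[0,1]:T(x)=y\}$. (i) The set $S_\infty^{loc}:=\{y\in[0,\frac23]: L(y)\text{ contains infinitely many different local level sets}\}$ is residual (co-meager) in $[0,\frac23]$. (ii) The set $S_\infty^{loc,uc}:=\{y\in[0,\frac23]: L(y)\text{ contains uncountably many different local level sets}\}$ is dense in $[0,\frac23]$, and intersects any nondegenerate subinterval of $[0,\frac23]$ in a set of the cardinality of the continuum.
   Context: The Takagi function is $T(x)=\sum_{n=0}^\infty 2^{-n}\phi(2^n x)$, where $\phi(x)=\operatorname{dist}(x,\mathbb{Z})$; its range on $[0,1]$ is $[0,\frac23]$. For $x\in[0,1)$ write $x=0.\varepsilon_1\varepsilon_2\dots$ in binary (dyadic rationals get the expansion ending in all zeros; for $x=1$ take all digits equal to $1$), and put $D_k(x)=\sum_{j=1}^k(-1)^{\varepsilon_j}$. Define an equivalence relation on $[0,1]$ by $x\sim x'$ iff $|D_j(x)|=|D_j(x')|$ for every $j\in\mathbb{N}$. The local level set containing $x$ is $L_x^{loc}=\{x':x'\sim x\}$. If $x\sim x'$ then $T(x)=T(x')$, so each level set $L(y)$ is a disjoint union of local level sets. *)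

theory Defs
  imports "HOL-Analysis.Analysis" "HOL-Library.Equipollence"
begin

definition takagi :: "real \<Rightarrow> real" where
  "takagi x = (\<Sum>n. infdist (2 ^ n * x) \<int> / 2 ^ n)"

lemma summable_takagi: "summable (\<lambda>n. infdist (2 ^ n * x) (\<int> :: real set) / 2 ^ n)"
proof (rule summable_comparison_test')
  show "summable (\<lambda>n. (1/2 :: real) ^ n)"
    by (rule summable_geometric) simp
next
  fix n :: nat
  let ?y = "2 ^ n * x"
  have "infdist ?y (\<int> :: real set) \<le> dist ?y (of_int \<lfloor>?y\<rfloor>)"
    by (rule infdist_le) simp
  also have "\<dots> \<le> 1"
    unfolding dist_real_def by linarith
  finally have "infdist ?y (\<int> :: real set) / 2 ^ n \<le> 1 / 2 ^ n"
    by (intro divide_right_mono) auto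
  then show "norm (infdist ?y (\<int> :: real set) / 2 ^ n) \<le> (1/2) ^ n"
    by (simp add: infdist_nonneg power_one_over)
qed

definition takagi_level :: "real \<Rightarrow> real set" where
  "takagi_level y = {x \<in> {0..1}. takagi x = y}"

text \<open>
  For \<open>0 \<le> x < 1\<close> and \<open>j \<ge> 1\<close>, \<open>\<lfloor>2 ^ j * x\<rfloor> mod 2\<close> is the \<open>j\<close>-th digit of the binary
  expansion of \<open>x\<close>, dyadic rationals getting the expansion ending in zeros.  The lemmas below
  confirm this.
\<close>

definition binary_digit :: "real \<Rightarrow> nat \<Rightarrow> nat" where
  "binary_digit x j = (if x = 1 then 1 else nat (\<lfloor>2 ^ j * x\<rfloor> mod 2))"

lemma binary_digit_le_1: "binary_digit x j \<in> {0, 1}"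
  unfolding binary_digit_def by (cases "even \<lfloor>2 ^ j * x\<rfloor>") (auto simp: odd_iff_mod_2_eq_one)

lemma floor_double:
  fixes y :: real
  shows "\<lfloor>2 * y\<rfloor> mod 2 = \<lfloor>2 * y\<rfloor> - 2 * \<lfloor>y\<rfloor>"
proof -
  have "\<lfloor>2 * y\<rfloor> div 2 = \<lfloor>y\<rfloor>"
    using floor_divide_real_eq_div[of 2 "2 * y"] by simp
  then show ?thesis
    by (simp add: minus_mult_div_eq_mod [symmetric])
qed

lemma binary_expansion_partial_sum:
  assumes "0 \<le> x" "x < 1"
  shows "(\<Sum>j<n. real (binary_digit x (Suc j)) / 2 ^ Suc j) = of_int \<lfloor>2 ^ n * x\<rfloor> / 2 ^ n"
proof (induction n)
  case 0
  then show ?case using assms by (simp add: floor_eq_iff)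
next
  case (Suc n)
  have "real (binary_digit x (Suc n)) = of_int (\<lfloor>2 ^ Suc n * x\<rfloor> mod 2)"
    using assms unfolding binary_digit_def by simp
  also have "\<dots> = of_int \<lfloor>2 ^ Suc n * x\<rfloor> - 2 * of_int \<lfloor>2 ^ n * x\<rfloor>"
    using floor_double[of "2 ^ n * x"] by (simp add: mult.assoc)
  finally show ?case
    using Suc by (simp add: field_simps)
qed

lemma floor_scaled_tendsto: "(\<lambda>n. of_int \<lfloor>2 ^ n * x\<rfloor> / 2 ^ n) \<longlonglongrightarrow> (x :: real)"
proof (rule tendsto_sandwich)
  show "\<forall>\<^sub>F n in sequentially. x - (1/2) ^ n \<le> of_int \<lfloor>2 ^ n * x\<rfloor> / 2 ^ n"
  proof (rule always_eventually, rule allI)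
    fix n :: nat
    have "2 ^ n * x - 1 \<le> of_int \<lfloor>2 ^ n * x\<rfloor>" by linarith
    then have "(2 ^ n * x - 1) / 2 ^ n \<le> of_int \<lfloor>2 ^ n * x\<rfloor> / 2 ^ n"
      by (rule divide_right_mono) simp
    then show "x - (1/2) ^ n \<le> of_int \<lfloor>2 ^ n * x\<rfloor> / 2 ^ n"
      by (simp add: diff_divide_distrib power_one_over)
  qed
  show "\<forall>\<^sub>F n in sequentially. of_int \<lfloor>2 ^ n * x\<rfloor> / 2 ^ n \<le> x"
    by (rule always_eventually) (simp add: divide_le_eq mult.commute)
  have "(\<lambda>n. x - (1/2) ^ n) \<longlonglongrightarrow> x - 0"
    by (intro tendsto_intros LIMSEQ_realpow_zero) auto
  then show "(\<lambda>n. x - (1/2) ^ n) \<longlonglongrightarrow> x" by simp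
qed auto

lemma binary_expansion_sums:
  assumes "x \<in> {0..1}"
  shows "(\<lambda>j. real (binary_digit x (Suc j)) / 2 ^ Suc j) sums x"
proof (cases "x = 1")
  case True
  then show ?thesis
    using power_half_series by (simp add: binary_digit_def power_one_over)
next
  case False
  then show ?thesis
    using assms floor_scaled_tendsto[of x]
    unfolding sums_def by (simp add: binary_expansion_partial_sum del: power_Suc)
qed

lemma binary_expansion_not_ending_in_ones:
  assumes "x \<in> {0..<1}"
  shows "\<exists>\<^sub>\<infinity>j. binary_digit x j = 0"
proof (rule ccontr)
  assume "\<not> (\<exists>\<^sub>\<infinity>j. binary_digit x j = 0)"
  then obtain N where N: "\<And>j. j > N \<Longrightarrow> binary_digit x j \<noteq> 0"
    unfolding INFM_nat by metis
  have one: "\<lfloor>2 ^ Suc j * x\<rfloor> = 2 * \<lfloor>2 ^ j * x\<rfloor> + 1" if "j \<ge> N" for j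
  proof -
    have "x \<noteq> 1" "binary_digit x (Suc j) \<noteq> 0"
      using assms N[of "Suc j"] that by simp_all
    then have "\<lfloor>2 ^ Suc j * x\<rfloor> mod 2 \<noteq> 0"
      unfolding binary_digit_def by (metis nat_zero_as_int)
    then have "\<lfloor>2 ^ Suc j * x\<rfloor> mod 2 = 1"
      by presburger
    moreover have "\<lfloor>2 ^ Suc j * x\<rfloor> mod 2 = \<lfloor>2 ^ Suc j * x\<rfloor> - 2 * \<lfloor>2 ^ j * x\<rfloor>"
      using floor_double[of "2 ^ j * x"] by (simp only: power_Suc mult.assoc)
    ultimately show ?thesis by linarith
  qed
  define f where "f = 1 - frac (2 ^ N * x)"
  have "f > 0" unfolding f_def using frac_lt_1[of "2 ^ N * x"] by simp
  have fr: "1 - frac (2 ^ (N + k) * x) = 2 ^ k * f" for k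
  proof (induction k)
    case 0
    then show ?case by (simp add: f_def)
  next
    case (Suc k)
    have "1 - frac (2 ^ (N + Suc k) * x) = 2 * (1 - frac (2 ^ (N + k) * x))"
      using one[of "N + k"] unfolding frac_def by simp
    then show ?case using Suc by simp
  qed
  obtain k where "1 / f < 2 ^ k"
    using real_arch_pow[of 2 "1 / f"] by auto
  then have "1 < 2 ^ k * f"
    using \<open>f > 0\<close> by (simp add: field_simps)
  then show False
    using fr[of k] frac_ge_0[of "2 ^ (N + k) * x"] by linarith
qed

definition digit_balance :: "nat \<Rightarrow> real \<Rightarrow> int" where
  "digit_balance k x = (\<Sum>j = 1..k. (-1) ^ binary_digit x j)"

definition local_equiv :: "(real \<times> real) set" where
  "local_equiv = {(x, x'). x \<in> {0..1} \<and> x' \<in> {0..1} \<and>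
     (\<forall>j. \<bar>digit_balance j x\<bar> = \<bar>digit_balance j x'\<bar>)}"

lemma equiv_local_equiv: "equiv {0..1} local_equiv"
  by (rule equivI) (auto simp: local_equiv_def refl_on_def sym_def trans_def)

text \<open>
  The local level sets are the elements of the quotient \<open>{0..1} // local_equiv\<close>.
\<close>

definition local_level_sets_in :: "real \<Rightarrow> real set set" where
  "local_level_sets_in y = {A \<in> {0..1} // local_equiv. A \<subseteq> takagi_level y}"

definition S_inf_loc :: "real set" where
  "S_inf_loc = {y \<in> {0..2/3}. infinite (local_level_sets_in y)}"

definition S_inf_loc_uc :: "real set" where
  "S_inf_loc_uc = {y \<in> {0..2/3}. uncountable (local_level_sets_in y)}"

definition nowhere_dense_in :: "'a topology \<Rightarrow> 'a set \<Rightarrow> bool" where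
  "nowhere_dense_in X N \<longleftrightarrow> N \<subseteq> topspace X \<and> X interior_of (X closure_of N) = {}"

definition meager_in :: "'a topology \<Rightarrow> 'a set \<Rightarrow> bool" where
  "meager_in X M \<longleftrightarrow> (\<exists>\<N>. countable \<N> \<and> (\<forall>N\<in>\<N>. nowhere_dense_in X N) \<and> M = \<Union>\<N>)"

definition residual_in :: "'a topology \<Rightarrow> 'a set \<Rightarrow> bool" where
  "residual_in X S \<longleftrightarrow> S \<subseteq> topspace X \<and> meager_in X (topspace X - S)"

end

theory Submission
  imports Defs
begin

text \<open>
  A balanced binary word \<open>p\<close> (as many zeros as ones) of length \<open>m\<close> satisfies
  \<open>T(p x) = T(p 0) + T(x) / 2\<^sup>m\<close> for \<open>x \<in> [0, 1]\<close>, and \<open>D\<^sub>m\<^sub>+\<^sub>j(p x) = D\<^sub>j(x)\<close>. By continuity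
  of \<open>T\<close> every interval of ordinates contains such a scaled copy of the whole graph, so it suffices
  to find many local level sets somewhere. This comes from a coincidence: the balanced words
  \<open>u = 001101001011\<close> and \<open>v = 010000011111\<close> have the same length and \<open>T(u 0) = T(v 0) = 69/128\<close>,
  but \<open>\<bar>D\<^sub>2\<bar>\<close> is 2 for \<open>u\<close> and 0 for \<open>v\<close>. Hence in any concatenation of words each \<open>u\<close> may be
  exchanged for a \<open>v\<close>, which preserves the value of \<open>T\<close> and changes the local level set. Finitely
  many exchangeable blocks, followed by an arbitrary tail, give open sets of ordinates with many
  local level sets; infinitely many give uncountably many local level sets in one level set, and
  interleaving them with blocks that do change the ordinate gives continuum many ordinates.
\<close>

section \<open>The distance to the nearest integer\<close>

lemma Ints_not_empty: "(\<int> :: 'a::ring_1 set) \<noteq> {}"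
  using Ints_0 by blast

lemma infdist_Ints_low:
  fixes x :: real
  assumes "0 \<le> x" "x \<le> 1/2"
  shows "infdist x \<int> = x"
proof (rule antisym)
  show "infdist x \<int> \<le> x"
    using infdist_le[of 0 "\<int>" x] assms by (simp add: dist_real_def)
  show "x \<le> infdist x \<int>"
    unfolding infdist_notempty[OF Ints_not_empty]
  proof (rule cINF_greatest)
    fix a :: real assume "a \<in> \<int>"
    then obtain k where k: "a = of_int k" by (auto elim: Ints_cases)
    show "x \<le> dist x a"
    proof (cases "k \<le> 0")
      case True
      then have "a \<le> 0" using k by simp
      then show ?thesis using assms by (simp add: dist_real_def)
    next
      case False
      then have "a \<ge> 1" using k by simp
      then show ?thesis using assms by (simp add: dist_real_def)
    qed
  qed (rule Ints_not_empty)
qed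

lemma infdist_Ints_high:
  fixes x :: real
  assumes "1/2 \<le> x" "x \<le> 1"
  shows "infdist x \<int> = 1 - x"
proof (rule antisym)
  show "infdist x \<int> \<le> 1 - x"
    using infdist_le[of 1 "\<int>" x] assms by (simp add: dist_real_def)
  show "1 - x \<le> infdist x \<int>"
    unfolding infdist_notempty[OF Ints_not_empty]
  proof (rule cINF_greatest)
    fix a :: real assume "a \<in> \<int>"
    then obtain k where k: "a = of_int k" by (auto elim: Ints_cases)
    show "1 - x \<le> dist x a"
    proof (cases "k \<le> 0")
      case True
      then have "a \<le> 0" using k by simp
      then show ?thesis using assms by (simp add: dist_real_def)
    next
      case False
      then have "a \<ge> 1" using k by simp
      then show ?thesis using assms by (simp add: dist_real_def)
    qed
  qed (rule Ints_not_empty)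
qed

lemma infdist_Ints_add:
  fixes x a :: real
  assumes "a \<in> \<int>"
  shows "infdist (a + x) \<int> = infdist x \<int>"
proof -
  have le: "infdist (b + y) \<int> \<le> infdist y \<int>" if "b \<in> \<int>" for b y :: real
    unfolding infdist_notempty[OF Ints_not_empty, of y]
  proof (rule cINF_greatest)
    fix c :: real assume "c \<in> \<int>"
    then show "infdist (b + y) \<int> \<le> dist y c"
      using infdist_le[of "b + c" "\<int>" "b + y"] that by (simp add: dist_real_def)
  qed (rule Ints_not_empty)
  show ?thesis
    using le[OF assms, of x] le[of "- a" "a + x"] assms by simp
qed

lemma infdist_Ints_le_half: "infdist x (\<int> :: real set) \<le> 1/2"
proof -
  have eq: "infdist x \<int> = infdist (frac x) \<int>"
    using infdist_Ints_add[of "of_int \<lfloor>x\<rfloor>" "frac x"] by (simp add: frac_def)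
  show ?thesis
  proof (cases "frac x \<le> 1/2")
    case True
    then show ?thesis unfolding eq by (simp add: infdist_Ints_low)
  next
    case False
    then show ?thesis unfolding eq
      using frac_lt_1[of x] by (simp add: infdist_Ints_high)
  qed
qed

section \<open>The Takagi function: bounds, functional equation, continuity\<close>

lemma takagi_nonneg: "0 \<le> takagi x"
  unfolding takagi_def by (intro suminf_nonneg summable_takagi) (simp add: infdist_nonneg)

lemma takagi_le_1: "takagi x \<le> 1"
proof -
  have "takagi x \<le> (\<Sum>n. (1/2 :: real) ^ Suc n)"
    unfolding takagi_def
  proof (rule suminf_le)
    show "infdist (2 ^ n * x) \<int> / 2 ^ n \<le> (1/2 :: real) ^ Suc n" for n
      using divide_right_mono[OF infdist_Ints_le_half[of "2 ^ n * x"], of "2 ^ n"]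
      by (simp add: power_one_over)
  qed (use summable_takagi power_half_series in \<open>auto simp: sums_iff\<close>)
  then show ?thesis
    using power_half_series by (simp add: sums_iff)
qed

lemma takagi_rec: "takagi x = infdist x \<int> + takagi (2 * x) / 2"
proof -
  have "takagi x = infdist x \<int> + (\<Sum>n. infdist (2 ^ Suc n * x) \<int> / 2 ^ Suc n)"
    unfolding takagi_def
    using suminf_split_head[OF summable_takagi[of x]] by simp
  also have "(\<Sum>n. infdist (2 ^ Suc n * x) \<int> / 2 ^ Suc n)
      = (\<Sum>n. infdist (2 ^ n * (2 * x)) \<int> / 2 ^ n / 2)"
    by (simp add: mult.assoc mult.left_commute mult.commute)
  also have "\<dots> = takagi (2 * x) / 2"
    unfolding takagi_def by (rule suminf_divide[OF summable_takagi])
  finally show ?thesis .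
qed

lemma takagi_add_1: "takagi (1 + x) = takagi x"
  unfolding takagi_def by (simp add: distrib_left infdist_Ints_add)

text \<open>The term \<open>n = 0\<close> is the distance of the halved point to its nearest
  integer; by periodicity the later terms add up to \<open>takagi x / 2\<close>.\<close>

lemma takagi_prepend_bit:
  assumes "x \<in> {0..1}"
  shows "takagi ((of_bool b + x) / 2) = ((if b then 1 - x else x) + takagi x) / 2"
proof -
  have "2 * ((of_bool b + x) / 2) = of_bool b + x"
    by simp
  then have "takagi ((of_bool b + x) / 2)
      = infdist ((of_bool b + x) / 2) \<int> + takagi (of_bool b + x) / 2"
    by (metis takagi_rec)
  moreover have "infdist ((of_bool b + x) / 2) \<int> = (if b then 1 - x else x) / 2"
    using assms by (cases b) (simp_all add: infdist_Ints_low infdist_Ints_high field_simps)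
  moreover have "takagi (of_bool b + x) = takagi x"
    by (cases b) (simp_all add: takagi_add_1)
  ultimately show ?thesis by (simp add: add_divide_distrib)
qed

text \<open>Doubling modulo 1 swaps 1/3 and 2/3, so \<open>takagi_rec\<close> yields two linear
  equations for the two values.\<close>

lemma takagi_one_third: "takagi (1/3) = 2/3"
proof -
  have "infdist (2/3 :: real) \<int> = 1/3"
    by (subst infdist_Ints_high) auto
  then have "takagi (2/3) = 1/3 + takagi (1/3) / 2"
    using takagi_rec[of "2/3"] takagi_add_1[of "1/3"] by simp
  moreover have "infdist (1/3 :: real) \<int> = 1/3"
    by (rule infdist_Ints_low) auto
  then have "takagi (1/3) = 1/3 + takagi (2/3) / 2"
    using takagi_rec[of "1/3"] by simp
  ultimately show ?thesis by linarith
qed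

lemma takagi_0: "takagi 0 = 0"
  using takagi_rec[of 0] by (simp add: infdist_Ints_low)

lemma continuous_on_takagi: "continuous_on A takagi"
proof -
  have "uniform_limit A (\<lambda>n x. \<Sum>i<n. infdist (2 ^ i * x) \<int> / 2 ^ i)
      (\<lambda>x. \<Sum>i. infdist (2 ^ i * x) \<int> / 2 ^ i) sequentially"
  proof (rule Weierstrass_m_test)
    fix n x
    show "norm (infdist (2 ^ n * x) (\<int> :: real set) / 2 ^ n) \<le> (1/2) ^ n"
      using infdist_Ints_le_half[of "2 ^ n * x"] infdist_nonneg[of "2 ^ n * x" "\<int>"]
      by (simp add: power_one_over divide_right_mono)
  qed (simp add: summable_geometric)
  then show ?thesis
    unfolding takagi_def[abs_def]
    by (rule uniform_limit_theorem[rotated])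
      (auto intro!: always_eventually continuous_intros continuous_on_infdist)
qed

text \<open>Intermediate values between 0 and 1/3; the preimage thus avoids the point 1 with its
  special digit convention.\<close>

lemma takagi_surj:
  assumes "y \<in> {0..2/3}"
  obtains x where "x \<in> {0..<1}" "takagi x = y"
proof -
  have "\<exists>x\<ge>0. x \<le> 1/3 \<and> takagi x = y"
    by (rule IVT') (use assms in \<open>auto simp: takagi_0 takagi_one_third continuous_on_takagi\<close>)
  then show ?thesis using that by force
qed

section \<open>Binary words as prefixes\<close>

fun prepend :: "bool list \<Rightarrow> real \<Rightarrow> real" where
  "prepend [] x = x"
| "prepend (b # w) x = (of_bool b + prepend w x) / 2"

fun word_balance :: "bool list \<Rightarrow> int" where
  "word_balance [] = 0"
| "word_balance (b # w) = (if b then -1 else 1) + word_balance w"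

lemma prepend_affine: "prepend w x = prepend w 0 + x / 2 ^ length w"
  by (induction w) (auto simp: field_simps)

lemma prepend_append: "prepend (v @ w) x = prepend v (prepend w x)"
  by (induction v) auto

lemma word_balance_append: "word_balance (v @ w) = word_balance v + word_balance w"
  by (induction v) auto

lemma word_balance_replicate: "word_balance (replicate n b) = (if b then - int n else int n)"
  by (induction n) auto

lemma prepend_in: "x \<in> {0..1} \<Longrightarrow> prepend w x \<in> {0..1}"
  by (induction w) (auto simp: of_bool_def)

lemma prepend_in_strict: "x \<in> {0..<1} \<Longrightarrow> prepend w x \<in> {0..<1}"
  by (induction w) (auto simp: of_bool_def)

text \<open>Each bit adds a term of slope 1 or -1 before halving, and the slopes accumulate to the
  balance of \<open>w\<close>. For a balanced word only a scaled copy of the graph is left.\<close>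

lemma takagi_prepend:
  assumes "x \<in> {0..1}"
  shows "takagi (prepend w x)
    = takagi (prepend w 0) + (takagi x + of_int (word_balance w) * x) / 2 ^ length w"
proof (induction w)
  case Nil
  then show ?case by (simp add: takagi_0)
next
  case (Cons b w)
  have x: "prepend w x \<in> {0..1}" and 0: "prepend w 0 \<in> {0..1}"
    using assms prepend_in by auto
  \<comment> \<open>Subtracting the value at the tail 0 removes the constant that a digit 1
    contributes.\<close>
  have "takagi (prepend (b # w) x) - takagi (prepend (b # w) 0)
      = ((if b then -1 else 1) * (prepend w x - prepend w 0)
          + (takagi (prepend w x) - takagi (prepend w 0))) / 2"
    unfolding prepend.simps takagi_prepend_bit[OF x] takagi_prepend_bit[OF 0]
    by (simp add: diff_divide_distrib add_divide_distrib)
  also have "prepend w x - prepend w 0 = x / 2 ^ length w"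
    using prepend_affine[of w x] by simp
  also have "takagi (prepend w x) - takagi (prepend w 0)
      = (takagi x + of_int (word_balance w) * x) / 2 ^ length w"
    using Cons by simp
  finally show ?case
    by (simp add: field_simps)
qed

section \<open>Digits and balances of prefixed points\<close>

lemma binary_digit_prepend_bit:
  assumes "x \<in> {0..<1}"
  shows "binary_digit ((of_bool b + x) / 2) (Suc j)
    = (if j = 0 then of_bool b else binary_digit x j)"
proof -
  have ne: "(of_bool b + x) / 2 \<noteq> 1" "x \<noteq> 1" using assms by (auto simp: of_bool_def)
  \<comment> \<open>The new digit adds the integer \<open>2 ^ j * of_bool b\<close>, which is even
    for \<open>j > 0\<close> and so affects the first digit only.\<close>
  have fl: "\<lfloor>2 ^ Suc j * ((of_bool b + x) / 2)\<rfloor> = 2 ^ j * of_bool b + \<lfloor>2 ^ j * x\<rfloor>"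
  proof -
    have "2 ^ Suc j * ((of_bool b + x) / 2) = of_int (2 ^ j * of_bool b) + 2 ^ j * x"
      by (simp add: algebra_simps)
    then show ?thesis by (metis floor_add_int add.commute)
  qed
  show ?thesis
  proof (cases j)
    case 0
    then have "\<lfloor>2 ^ j * x\<rfloor> = 0" using assms by (simp add: floor_eq_iff)
    then show ?thesis using 0 ne fl unfolding binary_digit_def by (simp add: of_bool_def)
  next
    case (Suc i)
    have "(2 ^ j * of_bool b + \<lfloor>2 ^ j * x\<rfloor>) mod 2 = \<lfloor>2 ^ j * x\<rfloor> mod 2"
      unfolding Suc power_Suc by (simp only: mult.assoc mod_mult_self4)
    then show ?thesis using ne fl Suc unfolding binary_digit_def by simp
  qed
qed

lemma digit_balance_0: "digit_balance 0 x = 0"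
  by (simp add: digit_balance_def)

lemma digit_balance_Suc: "digit_balance (Suc k) x = digit_balance k x + (-1) ^ binary_digit x (Suc k)"
  by (simp add: digit_balance_def)

lemma digit_balance_prepend_bit:
  assumes "x \<in> {0..<1}"
  shows "digit_balance (Suc j) ((of_bool b + x) / 2) = (if b then -1 else 1) + digit_balance j x"
  by (induction j)
    (simp_all add: digit_balance_0 digit_balance_Suc binary_digit_prepend_bit[OF assms])

lemma digit_balance_prepend:
  assumes "x \<in> {0..<1}"
  shows "digit_balance (length w + j) (prepend w x) = word_balance w + digit_balance j x"
  by (induction w) (use digit_balance_prepend_bit prepend_in_strict assms in auto)

lemma bit_cases:
  fixes x :: real
  assumes "x \<in> {0..<1}"
  obtains b x' where "x' \<in> {0..<1}" "x = (of_bool b + x') / 2"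
proof (cases "x < 1/2")
  case True
  then show ?thesis using assms that[of "2 * x" False] by simp
next
  case False
  then show ?thesis using assms that[of "2 * x - 1" True] by simp
qed

lemma word_cases:
  assumes "x \<in> {0..<1}"
  obtains w x' where "x' \<in> {0..<1}" "x = prepend w x'" "length w = n"
  using assms
proof (induction n arbitrary: x thesis)
  case 0
  then show ?case using 0(1)[of x "[]"] by simp
next
  case (Suc n)
  obtain b y where y: "y \<in> {0..<1}" "x = (of_bool b + y) / 2"
    using bit_cases[OF Suc.prems(2)] .
  obtain w z where "z \<in> {0..<1}" "y = prepend w z" "length w = n"
    using Suc.IH[OF _ y(1)] .
  then show ?case using y Suc.prems(1)[of z "b # w"] by simp
qed

text \<open>The first \<open>n\<close> digits of \<open>x\<close> already force the distance;
  appending equal digits restores the balance without leaving the dyadic interval.\<close>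

lemma balanced_word_approximation:
  assumes "x \<in> {0..<1}" "e > 0"
  obtains w where "word_balance w = 0" "\<And>z. z \<in> {0..<1} \<Longrightarrow> \<bar>prepend w z - x\<bar> < e"
proof -
  obtain n where n: "(1/2) ^ n < e"
    using real_arch_pow_inv[of e "1/2"] assms by auto
  obtain w x' where x': "x' \<in> {0..<1}" and x: "x = prepend w x'" and len: "length w = n"
    using word_cases[OF assms(1)] .
  let ?d = "word_balance w"
  \<comment> \<open>If \<open>?d > 0\<close>, the prefix has too many zeros and ones are appended;
    otherwise zeros.\<close>
  let ?v = "replicate (nat \<bar>?d\<bar>) (?d > 0)"
  show ?thesis
  proof (rule that)
    show "word_balance (w @ ?v) = 0"
      by (simp add: word_balance_append word_balance_replicate)
    fix z :: real assume "z \<in> {0..<1}"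
    then have "prepend ?v z \<in> {0..<1}" by (rule prepend_in_strict)
    then have "\<bar>prepend ?v z - x'\<bar> \<le> 1" using x' by auto
    then have "\<bar>prepend ?v z - x'\<bar> / 2 ^ n \<le> 1 / 2 ^ n" by (rule divide_right_mono) simp
    moreover have "prepend (w @ ?v) z - x = (prepend ?v z - x') / 2 ^ n"
      unfolding prepend_append x prepend_affine[of w "prepend ?v z"] prepend_affine[of w x'] len
      by (simp add: diff_divide_distrib)
    ultimately show "\<bar>prepend (w @ ?v) z - x\<bar> < e"
      using n by (simp add: power_one_over)
  qed
qed

section \<open>Constancy of the Takagi function on local level sets\<close>

text \<open>
  For \<open>D \<ge> 0\<close> this is \<open>T(x) + D x\<close>; for \<open>D < 0\<close> it is the value of the same expression for
  \<open>-D\<close> at the reflected point \<open>1 - x\<close>. Its recursion under the digit shift involves the balances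
  only through their absolute values, which makes \<open>T\<close> constant on local level sets.
\<close>

definition skew_takagi :: "int \<Rightarrow> real \<Rightarrow> real" where
  "skew_takagi D x = takagi x + of_int D * x + max 0 (- of_int D)"

text \<open>The extra term appears only when the new digit moves the balance towards 0, so it is
  determined by \<open>\<bar>D\<bar>\<close> and \<open>\<bar>D + s\<bar>\<close>.\<close>

lemma skew_takagi_prepend_bit:
  fixes b :: bool
  assumes "x \<in> {0..1}"
  defines "s \<equiv> (if b then -1 else 1 :: int)"
  shows "skew_takagi D ((of_bool b + x) / 2)
    = (skew_takagi (D + s) x + (if \<bar>D + s\<bar> < \<bar>D\<bar> then of_int \<bar>D\<bar> + 1 else 0)) / 2"
proof -
  \<comment> \<open>In each case \<open>D\<close> and \<open>D + s\<close> never have opposite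
    signs, so both maxima resolve.\<close>
  consider "D = 0" | "D \<ge> 1" | "D \<le> -1" by linarith
  then show ?thesis
    unfolding skew_takagi_def takagi_prepend_bit[OF assms(1)] s_def
    by cases (cases b; simp add: field_simps max_def)+
qed

lemma skew_takagi_bounds:
  assumes "x \<in> {0..1}"
  shows "0 \<le> skew_takagi D x" "skew_takagi D x \<le> of_int \<bar>D\<bar> + 1"
proof -
  have "real_of_int D * x + max 0 (- of_int D) \<in> {0..of_int \<bar>D\<bar>}"
  proof (cases "D \<ge> 0")
    case True
    then show ?thesis using assms by (simp add: mult_left_le)
  next
    case False
    then have "0 \<le> real_of_int (-D) * (1 - x)" "real_of_int (-D) * (1 - x) \<le> real_of_int (-D)"
      using assms by (intro mult_nonneg_nonneg mult_left_le; simp)+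
    then show ?thesis using False by (simp add: algebra_simps)
  qed
  then show "0 \<le> skew_takagi D x" "skew_takagi D x \<le> of_int \<bar>D\<bar> + 1"
    unfolding skew_takagi_def using takagi_nonneg[of x] takagi_le_1[of x] by auto
qed

text \<open>The point 1 is fixed by prepending the digit 1 and has only digits 1, so the first digit
  can be removed on the closed interval too.\<close>

lemma bit_shift_cases:
  assumes "x \<in> {0..1}"
  obtains b x' where "x' \<in> {0..1}" "x = (of_bool b + x') / 2"
    "\<And>j. digit_balance (Suc j) x = (if b then -1 else 1) + digit_balance j x'"
proof (cases "x = 1")
  case True
  have "digit_balance j 1 = - int j" for j
    by (simp add: digit_balance_def binary_digit_def)
  then show ?thesis using True that[of 1 True] by simp
next
  case False
  then have "x \<in> {0..<1}" using assms by simp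
  then obtain b x' where b: "x' \<in> {0..<1}" "x = (of_bool b + x') / 2"
    by (rule bit_cases)
  show ?thesis
    using b(1) that[of x' b, OF _ b(2)] digit_balance_prepend_bit[OF b(1), of _ b]
    unfolding b(2) by auto
qed

text \<open>The extra terms of the two recursions agree and cancel, so each digit halves the
  difference. After \<open>n\<close> digits the absolute balance is at most
  \<open>\<bar>D\<bar> + n\<close>, and \<open>skew_takagi_bounds\<close> controls what remains. The
  balances may have opposite signs, hence separate \<open>D\<close> and \<open>D'\<close>.\<close>

lemma skew_takagi_cong:
  assumes "x \<in> {0..1}" "x' \<in> {0..1}" "\<And>j. \<bar>D + digit_balance j x\<bar> = \<bar>D' + digit_balance j x'\<bar>"
  shows "\<bar>skew_takagi D x - skew_takagi D' x'\<bar> \<le> (of_int \<bar>D\<bar> + real n + 1) / 2 ^ n"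
  using assms
proof (induction n arbitrary: D D' x x')
  case 0
  have "\<bar>D\<bar> = \<bar>D'\<bar>" using 0(3)[of 0] by (simp add: digit_balance_0)
  then show ?case
    using skew_takagi_bounds[OF 0(1), of D] skew_takagi_bounds[OF 0(2), of D'] by simp
next
  case (Suc n)
  obtain b z where z: "z \<in> {0..1}" "x = (of_bool b + z) / 2"
    "\<And>j. digit_balance (Suc j) x = (if b then -1 else 1) + digit_balance j z"
    using bit_shift_cases[OF Suc.prems(1)] by blast
  obtain b' z' where z': "z' \<in> {0..1}" "x' = (of_bool b' + z') / 2"
    "\<And>j. digit_balance (Suc j) x' = (if b' then -1 else 1) + digit_balance j z'"
    using bit_shift_cases[OF Suc.prems(2)] by blast
  define s s' :: int where "s = (if b then -1 else 1)" and "s' = (if b' then -1 else 1)"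
  have eq: "\<bar>(D + s) + digit_balance j z\<bar> = \<bar>(D' + s') + digit_balance j z'\<bar>" for j
    using Suc.prems(3)[of "Suc j"] z(3) z'(3) by (simp add: s_def s'_def add.assoc)
  \<comment> \<open>The hypothesis at \<open>j = 0\<close> and \<open>j = 1\<close> makes the extra
    terms equal.\<close>
  have D: "\<bar>D\<bar> = \<bar>D'\<bar>" using Suc.prems(3)[of 0] by (simp add: digit_balance_0)
  have Ds: "\<bar>D + s\<bar> = \<bar>D' + s'\<bar>" using eq[of 0] by (simp add: digit_balance_0)
  have "skew_takagi D x - skew_takagi D' x'
      = (skew_takagi (D + s) z - skew_takagi (D' + s') z') / 2"
    unfolding z(2) z'(2) skew_takagi_prepend_bit[OF z(1)] skew_takagi_prepend_bit[OF z'(1)]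
    using D Ds by (simp add: s_def s'_def diff_divide_distrib add_divide_distrib)
  moreover have "\<bar>skew_takagi (D + s) z - skew_takagi (D' + s') z'\<bar>
      \<le> (of_int \<bar>D + s\<bar> + real n + 1) / 2 ^ n"
    by (rule Suc.IH[OF z(1) z'(1) eq])
  moreover have "(of_int \<bar>D + s\<bar> + real n + 1) / 2 ^ n \<le> (of_int \<bar>D\<bar> + real (Suc n) + 1) / 2 ^ n"
    by (rule divide_right_mono) (auto simp: s_def)
  ultimately show ?case by (simp add: abs_divide)
qed

text \<open>Both balances start at 0 in \<open>skew_takagi_cong\<close>, whose bound tends to
  0.\<close>

lemma takagi_local_equiv:
  assumes "(x, x') \<in> local_equiv"
  shows "takagi x = takagi x'"
proof -
  have "\<bar>skew_takagi 0 x - skew_takagi 0 x'\<bar> \<le> (real n + 1) / 2 ^ n" for n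
    using skew_takagi_cong[of x x' 0 0 n] assms by (simp add: local_equiv_def)
  moreover have "(\<lambda>n. (real n + 1) / 2 ^ n) \<longlonglongrightarrow> 0"
    using tendsto_add[OF powser_times_n_limit_0[of "1/2 :: real"] LIMSEQ_realpow_zero[of "1/2 :: real"]]
    by (simp add: power_one_over add_divide_distrib)
  ultimately have "\<bar>skew_takagi 0 x - skew_takagi 0 x'\<bar> \<le> 0"
    by (intro LIMSEQ_le_const) auto
  then show ?thesis by (simp add: skew_takagi_def)
qed

section \<open>Counting local level sets by inequivalent points\<close>

lemma local_level_sets_lepoll:
  assumes "\<And>i. i \<in> I \<Longrightarrow> f i \<in> takagi_level y"
    and "\<And>i j. i \<in> I \<Longrightarrow> j \<in> I \<Longrightarrow> (f i, f j) \<in> local_equiv \<Longrightarrow> i = j"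
  shows "I \<lesssim> local_level_sets_in y"
proof -
  have f01: "f i \<in> {0..1}" if "i \<in> I" for i
    using assms(1)[OF that] by (simp add: takagi_level_def)
  have "inj_on (\<lambda>i. local_equiv `` {f i}) I"
    by (rule inj_onI) (metis assms(2) eq_equiv_class[OF _ equiv_local_equiv] f01)
  moreover have "local_equiv `` {f i} \<in> local_level_sets_in y" if "i \<in> I" for i
  proof -
    have "x' \<in> takagi_level y" if "(f i, x') \<in> local_equiv" for x'
      using takagi_local_equiv[OF that] that assms(1)[OF \<open>i \<in> I\<close>]
      by (simp add: takagi_level_def local_equiv_def)
    then show ?thesis
      using f01[OF that] by (auto simp: local_level_sets_in_def intro: quotientI)
  qed
  ultimately show ?thesis unfolding lepoll_def by blast
qed

text \<open>After a balanced prefix the balance is back at 0, so from index \<open>length w\<close>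
  on it is that of the tail.\<close>

lemma local_equiv_prependD:
  assumes "(prepend w x, prepend w' x') \<in> local_equiv"
    and "length w = length w'" "word_balance w = 0" "word_balance w' = 0"
    and "x \<in> {0..<1}" "x' \<in> {0..<1}"
  shows "(x, x') \<in> local_equiv"
proof -
  have "\<bar>digit_balance j x\<bar> = \<bar>digit_balance j x'\<bar>" for j
  proof -
    have "\<bar>digit_balance (length w + j) (prepend w x)\<bar> = \<bar>digit_balance (length w + j) (prepend w' x')\<bar>"
      using assms(1) by (simp add: local_equiv_def)
    then show ?thesis
      using digit_balance_prepend[OF assms(5), of w j] digit_balance_prepend[OF assms(6), of w' j]
        assms(2-4) by simp
  qed
  then show ?thesis using assms(5,6) by (auto simp: local_equiv_def)
qed

section \<open>The exchangeable blocks and their values\<close>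

fun word_takagi :: "bool list \<Rightarrow> real" where
  "word_takagi [] = 0"
| "word_takagi (b # w) = ((if b then 1 - prepend w 0 else prepend w 0) + word_takagi w) / 2"

text \<open>Turns values at dyadic points into a recursion that arithmetic evaluates on concrete
  words.\<close>

lemma takagi_prepend_0: "takagi (prepend w 0) = word_takagi w"
proof (induction w)
  case (Cons b w)
  then show ?case
    using takagi_prepend_bit[OF prepend_in[of 0 w], of b] by simp
qed (simp add: takagi_0)

lemma takagi_prepend_balanced:
  assumes "x \<in> {0..1}" "word_balance w = 0"
  shows "takagi (prepend w x) = word_takagi w + takagi x / 2 ^ length w"
  using takagi_prepend[OF assms(1), of w] assms(2) by (simp add: takagi_prepend_0)

definition block_u :: "bool list" where
  "block_u = [False, False, True, True, False, True, False, False, True, False, True, True]"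

definition block_v :: "bool list" where
  "block_v = [False, True, False, False, False, False, False, True, True, True, True, True]"

text \<open>The block that changes the ordinate: its value lies far below the common value of
  \<open>block_u\<close> and \<open>block_v\<close>.\<close>

definition block_w :: "bool list" where
  "block_w = [False, False, False, False, False, False, True, True, True, True, True, True]"

definition blocks :: "bool list set" where
  "blocks = {block_u, block_v, block_w}"

text \<open>All blocks start with the digit 0; the resulting bound 1/2 keeps infinite concatenations
  below 1.\<close>

lemma block_simps:
  assumes "w \<in> blocks"
  shows "length w = 12" "word_balance w = 0" "prepend w 0 \<in> {0..1/2}"
  using assms by (auto simp: blocks_def block_u_def block_v_def block_w_def)

lemma word_takagi_block_u: "word_takagi block_u = 69/128"
  by (simp only: block_u_def word_takagi.simps prepend.simps if_True if_False of_bool_eq) simp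

lemma word_takagi_block_v: "word_takagi block_v = 69/128"
  by (simp only: block_v_def word_takagi.simps prepend.simps if_True if_False of_bool_eq) simp

lemma word_takagi_block_w: "word_takagi block_w < 1/4"
  by (simp only: block_w_def word_takagi.simps prepend.simps if_True if_False of_bool_eq) simp

text \<open>\<open>4096 = 2 ^ 12\<close> is the contraction by one block. Since values of
  \<open>takagi\<close> differ by at most 1, no choice of tails can compensate a larger gap.\<close>

lemma blocks_takagi_gap:
  assumes "w \<in> blocks" "w' \<in> blocks" "word_takagi w \<noteq> word_takagi w'"
  shows "\<bar>word_takagi w - word_takagi w'\<bar> > 1 / 4096"
  using assms word_takagi_block_u word_takagi_block_v word_takagi_block_w
  by (auto simp: blocks_def)

lemma takagi_prepend_block:
  assumes "x \<in> {0..1}" "w \<in> blocks"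
  shows "takagi (prepend w x) = word_takagi w + takagi x / 4096"
  using takagi_prepend_balanced[OF assms(1)] block_simps[OF assms(2)] by simp

lemma digit_balance_2_block:
  assumes "x \<in> {0..<1}" "w \<in> blocks"
  shows "digit_balance 2 (prepend w x) = (if w = block_v then 0 else 2)"
proof -
  have "digit_balance 2 (prepend ([a, b] @ w') x) = word_balance [a, b]" for a b w'
    using digit_balance_prepend[OF prepend_in_strict[OF assms(1)], of "[a, b]" 0 w']
    by (simp add: prepend_append digit_balance_0 numeral_2_eq_2)
  from this[of "w ! 0" "w ! 1" "drop 2 w"] show ?thesis
    using assms(2) by (auto simp: blocks_def block_u_def block_v_def block_w_def numeral_2_eq_2)
qed

text \<open>At index 2 the balance vanishes for \<open>block_v\<close> alone, so equivalence
  recognises this block but does not separate \<open>block_u\<close> from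
  \<open>block_w\<close>.\<close>

lemma local_equiv_blockD:
  assumes "(prepend w x, prepend w' x') \<in> local_equiv"
    and "w \<in> blocks" "w' \<in> blocks" "x \<in> {0..<1}" "x' \<in> {0..<1}"
  shows "w = block_v \<longleftrightarrow> w' = block_v" "(x, x') \<in> local_equiv"
proof -
  have "\<bar>digit_balance 2 (prepend w x)\<bar> = \<bar>digit_balance 2 (prepend w' x')\<bar>"
    using assms(1) by (simp add: local_equiv_def)
  then show "w = block_v \<longleftrightarrow> w' = block_v"
    by (simp add: digit_balance_2_block[OF assms(4) assms(2)] digit_balance_2_block[OF assms(5) assms(3)]
        split: if_splits)
  show "(x, x') \<in> local_equiv"
    using local_equiv_prependD[OF assms(1) _ _ _ assms(4,5)] block_simps assms(2,3) by simp
qed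

section \<open>Small intervals of ordinates with many inequivalent points\<close>

lemma takagi_small_interval:
  assumes "0 \<le> a" "a < b" "b \<le> 2/3"
  obtains p where "word_balance p = 0"
    "\<And>z. z \<in> {0..<1} \<Longrightarrow> takagi (prepend p z) \<in> {a<..<b}"
proof -
  obtain x where x: "x \<in> {0..<1}" "takagi x = (a + b) / 2"
    using takagi_surj[of "(a + b) / 2"] assms by auto
  have "(b - a) / 2 > 0" using assms by simp
  then obtain d where d: "d > 0" "\<And>x'. dist x' x < d \<Longrightarrow> dist (takagi x') (takagi x) < (b - a) / 2"
    using continuous_on_takagi[of UNIV] unfolding continuous_on_iff by (metis UNIV_I)
  obtain p where p: "word_balance p = 0" "\<And>z. z \<in> {0..<1} \<Longrightarrow> \<bar>prepend p z - x\<bar> < d"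
    using balanced_word_approximation[OF x(1) d(1)] by blast
  show ?thesis
  proof (rule that[OF p(1)])
    fix z :: real assume "z \<in> {0..<1}"
    then have "\<bar>takagi (prepend p z) - (a + b) / 2\<bar> < (b - a) / 2"
      using d(2)[of "prepend p z"] p(2) x(2) by (simp add: dist_real_def)
    then have "takagi (prepend p z) - (a + b) / 2 < (b - a) / 2"
      "(a + b) / 2 - takagi (prepend p z) < (b - a) / 2" by linarith+
    then show "takagi (prepend p z) \<in> {a<..<b}" by (simp add: field_simps)
  qed
qed

definition inequivalent :: "real set \<Rightarrow> bool" where
  "inequivalent X \<longleftrightarrow> X \<subseteq> {0..<1} \<and> (\<forall>x\<in>X. \<forall>x'\<in>X. (x, x') \<in> local_equiv \<longrightarrow> x = x')"

lemma inj_prepend: "inj (prepend w)"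
  by (rule injI) (metis prepend_affine add_left_cancel divide_cancel_right power_not_zero zero_neq_numeral)

lemma inequivalent_prepend:
  assumes "inequivalent X" "word_balance w = 0"
  shows "inequivalent (prepend w ` X)"
proof -
  have sub: "X \<subseteq> {0..<1}"
    and ineq: "\<And>x x'. x \<in> X \<Longrightarrow> x' \<in> X \<Longrightarrow> (x, x') \<in> local_equiv \<Longrightarrow> x = x'"
    using assms(1) by (auto simp: inequivalent_def)
  have "prepend w x = prepend w x'"
    if "x \<in> X" "x' \<in> X" "(prepend w x, prepend w x') \<in> local_equiv" for x x'
    using local_equiv_prependD[OF that(3) refl assms(2) assms(2)] ineq sub that(1,2) by blast
  moreover have "prepend w ` X \<subseteq> {0..<1}"
    using sub prepend_in_strict by blast
  ultimately show ?thesis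
    unfolding inequivalent_def by blast
qed

text \<open>Each round puts \<open>block_u\<close> before all points found so far and
  \<open>block_v\<close> before one of them. Both blocks move ordinates by the same affine map, and
  index 2 separates the new point from the others, so a round gains one point.\<close>

lemma ex_inequivalent_points:
  assumes "z \<in> {0..<1}"
  shows "\<exists>X. inequivalent X \<and> finite X \<and> card X = Suc n
    \<and> (\<forall>x\<in>X. takagi x = ((\<lambda>y. 69/128 + y / 4096) ^^ n) (takagi z))"
proof (induction n)
  case 0
  show ?case
    by (rule exI[of _ "{z}"]) (use assms in \<open>simp add: inequivalent_def\<close>)
next
  case (Suc n)
  let ?g = "\<lambda>y :: real. 69/128 + y / 4096"
  obtain X where X: "inequivalent X" "finite X" "card X = Suc n"
    "\<And>x. x \<in> X \<Longrightarrow> takagi x = (?g ^^ n) (takagi z)"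
    using Suc by auto
  have u: "block_u \<in> blocks" and v: "block_v \<in> blocks" and uv: "block_u \<noteq> block_v"
    by (auto simp: blocks_def) (simp add: block_u_def block_v_def)
  have X1: "x \<in> {0..<1}" "x \<in> {0..1}" if "x \<in> X" for x
    using X(1) that by (auto simp: inequivalent_def)
  obtain x0 where x0: "x0 \<in> X" using X(3) by force
  have ne: "(prepend block_v x0, prepend block_u x) \<notin> local_equiv"
    "(prepend block_u x, prepend block_v x0) \<notin> local_equiv" if "x \<in> X" for x
    using local_equiv_blockD(1) u v uv X1 x0 that by metis+
  have "prepend block_v x0 \<notin> prepend block_u ` X"
  proof
    assume "prepend block_v x0 \<in> prepend block_u ` X"
    then obtain x where "x \<in> X" "prepend block_v x0 = prepend block_u x" by blast
    moreover have "(prepend block_v x0, prepend block_v x0) \<in> local_equiv"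
      using prepend_in[OF X1(2)[OF x0]] by (auto simp: local_equiv_def)
    ultimately show False using ne by metis
  qed
  then have card: "card (insert (prepend block_v x0) (prepend block_u ` X)) = Suc (Suc n)"
    using X(2,3) by (simp add: card_image inj_on_subset[OF inj_prepend])
  have "inequivalent (insert (prepend block_v x0) (prepend block_u ` X))"
    using inequivalent_prepend[OF X(1), of block_u] block_simps(2)[OF u] ne
      prepend_in_strict[OF X1(1)[OF x0], of block_v]
    unfolding inequivalent_def by auto
  moreover have "takagi x = (?g ^^ Suc n) (takagi z)"
    if "x \<in> insert (prepend block_v x0) (prepend block_u ` X)" for x
    using that X1(2) x0 X(4)
    by (auto simp: takagi_prepend_block u v word_takagi_block_u word_takagi_block_v)
  ultimately show ?case
    using card X(2) by (intro exI[of _ "insert (prepend block_v x0) (prepend block_u ` X)"]) simp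
qed

text \<open>The tail \<open>z\<close> behind the exchangeable blocks is free, so the ordinates
  reached fill a whole interval.\<close>

lemma ex_open_interval_many_points:
  fixes a b :: real
  assumes "0 \<le> a" "a < b" "b \<le> 2/3"
  obtains c d where "c < d" "{c<..<d} \<subseteq> {a<..<b}"
    "\<And>y. y \<in> {c<..<d} \<Longrightarrow> \<exists>X. X \<subseteq> takagi_level y \<and> inequivalent X \<and> finite X \<and> card X = Suc n"
proof -
  obtain p where p: "word_balance p = 0"
    "\<And>z. z \<in> {0..<1} \<Longrightarrow> takagi (prepend p z) \<in> {a<..<b}"
    using takagi_small_interval[OF assms] by blast
  let ?g = "\<lambda>y :: real. 69/128 + y / 4096"
  \<comment> \<open>\<open>A\<close> is the ordinate for a tail of ordinate 0 and \<open>B\<close>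
    the total contraction: a tail \<open>z\<close> leads to \<open>A + B * takagi z\<close>.\<close>
  define A where "A = word_takagi p + (?g ^^ n) 0 / 2 ^ length p"
  define B :: real where "B = 1 / 4096 ^ n / 2 ^ length p"
  have g: "(?g ^^ n) y = (?g ^^ n) 0 + y / 4096 ^ n" for y
    by (induction n) (simp_all add: field_simps)
  have "B > 0" by (simp add: B_def)
  \<comment> \<open>The last conjunct holds because \<open>y\<close> is attained behind the prefix
    \<open>p\<close>; it yields the inclusion of the intervals.\<close>
  have key: "\<exists>X. X \<subseteq> takagi_level y \<and> inequivalent X \<and> finite X \<and> card X = Suc n \<and> y \<in> {a<..<b}"
    if y: "y \<in> {A<..<A + 2/3 * B}" for y
  proof -
    have "(y - A) / B \<in> {0..2/3}"
      using y \<open>B > 0\<close> by (simp add: field_simps)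
    then obtain z where z: "z \<in> {0..<1}" "takagi z = (y - A) / B"
      by (rule takagi_surj)
    have yz: "y = word_takagi p + (?g ^^ n) (takagi z) / 2 ^ length p"
    proof -
      have "y = A + B * takagi z" using z \<open>B > 0\<close> by simp
      then show ?thesis
        unfolding g[of "takagi z"] A_def B_def by (simp add: add_divide_distrib)
    qed
    obtain X where X: "inequivalent X" "finite X" "card X = Suc n"
      "\<And>x. x \<in> X \<Longrightarrow> takagi x = (?g ^^ n) (takagi z)"
      using ex_inequivalent_points[OF z(1), of n] by auto
    have X1: "x \<in> {0..<1}" "x \<in> {0..1}" if "x \<in> X" for x
      using X(1) that by (auto simp: inequivalent_def)
    have Ty: "takagi (prepend p x) = y" if "x \<in> X" for x
      using takagi_prepend_balanced[OF X1(2)[OF that] p(1)] X(4)[OF that] yz by simp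
    obtain x0 where x0: "x0 \<in> X" using X(3) by force
    have "prepend p ` X \<subseteq> takagi_level y"
      using Ty prepend_in[OF X1(2)] by (auto simp: takagi_level_def)
    moreover have "card (prepend p ` X) = Suc n"
      using X(3) by (simp add: card_image inj_on_subset[OF inj_prepend])
    moreover have "y \<in> {a<..<b}"
      using p(2)[OF X1(1)[OF x0]] Ty[OF x0] by simp
    ultimately show ?thesis
      using inequivalent_prepend[OF X(1) p(1)] X(2) by blast
  qed
  show ?thesis
  proof (rule that)
    show "A < A + 2/3 * B" using \<open>B > 0\<close> by simp
    show "{A<..<A + 2/3 * B} \<subseteq> {a<..<b}" using key by blast
  qed (use key in blast)
qed

section \<open>Residuality\<close>

lemma openin_Icc_contains_Ioo:
  fixes l r :: real
  assumes "openin (top_of_set {l..r}) U" "U \<noteq> {}" "l < r"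
  obtains a b where "l \<le> a" "a < b" "b \<le> r" "{a<..<b} \<subseteq> U"
proof -
  obtain V where V: "open V" "U = {l..r} \<inter> V"
    using assms(1) by (auto simp: openin_open)
  obtain y where y: "y \<in> U" using assms(2) by blast
  then obtain e where e: "e > 0" "ball y e \<subseteq> V"
    using V open_contains_ball by blast
  have sub: "{y - e<..<y + e} \<subseteq> V"
    using e(2) by (auto simp: ball_def dist_real_def subset_iff abs_if)
  show ?thesis
    \<comment> \<open>Clipping to \<open>{l..r}\<close> leaves a nondegenerate interval even if
      \<open>y\<close> is an endpoint, since \<open>l < r\<close>.\<close>
    by (rule that[of "max l (y - e)" "min r (y + e)"])
      (use V(2) y e(1) sub assms(3) in auto)
qed

lemma residual_S_inf_loc: "residual_in (top_of_set {0..2/3}) S_inf_loc"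
proof -
  let ?X = "top_of_set {0..2/3 :: real}"
  define Q where "Q n y \<longleftrightarrow> (\<exists>X. X \<subseteq> takagi_level y \<and> inequivalent X \<and> finite X \<and> card X = Suc n)"
    for n y
  \<comment> \<open>Cut down to the complement of \<open>S_inf_loc\<close>, because
    \<open>meager_in\<close> asks for a union equal to the set.\<close>
  define E where "E n = {y \<in> {0..2/3} - S_inf_loc. \<not> Q n y}" for n
  have "nowhere_dense_in ?X (E n)" for n
  proof -
    have "U = {}" if U: "openin ?X U" "U \<subseteq> ?X closure_of E n" for U
    proof (rule ccontr)
      assume "U \<noteq> {}"
      then obtain a b where ab: "0 \<le> a" "a < b" "b \<le> 2/3" "{a<..<b} \<subseteq> U"
        using openin_Icc_contains_Ioo[OF U(1)] by auto
      obtain c d where cd: "c < d" "{c<..<d} \<subseteq> {a<..<b}" "\<And>y. y \<in> {c<..<d} \<Longrightarrow> Q n y"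
        using ex_open_interval_many_points[OF ab(1-3), of n] unfolding Q_def by blast
      have "(c + d) / 2 \<in> {c<..<d}" using cd(1) by (simp add: field_simps)
      moreover from this have "(c + d) / 2 \<in> ?X closure_of E n"
        using cd(2) ab(4) U(2) by blast
      moreover have "{c<..<d} \<subseteq> {0..2/3}"
        using cd(2) ab(1,3) by (auto simp: subset_iff)
      then have "openin ?X {c<..<d}"
        by (simp add: open_subset)
      ultimately obtain y where "y \<in> E n" "y \<in> {c<..<d}"
        unfolding in_closure_of by blast
      then show False using cd(3) by (simp add: E_def)
    qed
    then have "?X interior_of (?X closure_of E n) = {}"
      unfolding interior_of_def by blast
    then show ?thesis by (auto simp: nowhere_dense_in_def E_def)
  qed
  moreover have "{0..2/3} - S_inf_loc = \<Union> (range E)"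
  proof -
    have "\<exists>n. \<not> Q n y" if "y \<in> {0..2/3} - S_inf_loc" for y
    proof (rule ccontr)
      assume "\<nexists>n. \<not> Q n y"
      \<comment> \<open>The failing \<open>n\<close> is the number of local level sets: one point
        too many.\<close>
      then obtain X where X: "X \<subseteq> takagi_level y" "inequivalent X" "finite X"
        "card X = Suc (card (local_level_sets_in y))"
        unfolding Q_def by blast
      have "X \<lesssim> local_level_sets_in y"
        by (rule local_level_sets_lepoll[where f = id]) (use X in \<open>auto simp: inequivalent_def\<close>)
      moreover have "finite (local_level_sets_in y)"
        using that by (auto simp: S_inf_loc_def)
      ultimately have "card X \<le> card (local_level_sets_in y)"
        by (metis lepoll_iff_card_le X(3))
      then show False using X(4) by simp
    qed
    then show ?thesis unfolding E_def by blast
  qed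
  ultimately show ?thesis
    unfolding residual_in_def meager_in_def
    by (auto intro!: exI[of _ "range E"] simp: S_inf_loc_def)
qed

section \<open>Infinite concatenations of blocks\<close>

definition infinite_word :: "(nat \<Rightarrow> bool list) \<Rightarrow> real" where
  "infinite_word s = (\<Sum>j. prepend (s j) 0 / 4096 ^ j)"

text \<open>All blocks have 12 digits and \<open>4096 = 2 ^ 12\<close>, so splitting off the first
  summand peels off the first block.\<close>

lemma infinite_word:
  assumes "\<And>j. s j \<in> blocks"
  shows "infinite_word s = prepend (s 0) (infinite_word (\<lambda>j. s (Suc j)))"
    and "infinite_word s \<in> {0..<1}"
proof -
  have sg: "summable (\<lambda>j. 1/2 * (1/4096 :: real) ^ j)"
    by (intro summable_mult summable_geometric) simp
  have bd: "0 \<le> prepend (s j) 0 / 4096 ^ j" "prepend (s j) 0 / 4096 ^ j \<le> 1/2 * (1/4096) ^ j" for j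
    using block_simps(3)[OF assms[of j]] divide_right_mono[of "prepend (s j) 0" "1/2" "4096 ^ j"]
    by (simp_all add: power_one_over)
  have sm: "summable (\<lambda>j. prepend (s j) 0 / 4096 ^ j)"
    by (rule summable_comparison_test'[OF sg, of 0])
      (unfold real_norm_def abs_of_nonneg[OF bd(1)], rule bd(2))
  \<comment> \<open>The majorant sums to \<open>4096 / 8190\<close>, strictly below 1.\<close>
  have "infinite_word s \<le> (\<Sum>j. 1/2 * (1/4096) ^ j)"
    unfolding infinite_word_def by (rule suminf_le[OF bd(2) sm sg])
  also have "\<dots> = 1/2 * (\<Sum>j. (1/4096) ^ j)"
    by (intro suminf_mult summable_geometric) simp
  also have "\<dots> < 1"
    by (subst suminf_geometric) auto
  finally show "infinite_word s \<in> {0..<1}"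
    using suminf_nonneg[OF sm bd(1)] by (simp add: infinite_word_def)
  have "summable (\<lambda>j. prepend (s (Suc j)) 0 / 4096 ^ Suc j)"
    using sm by (subst summable_Suc_iff)
  then have sm': "summable (\<lambda>j. prepend (s (Suc j)) 0 / 4096 ^ j)"
    using summable_mult[of "\<lambda>j. prepend (s (Suc j)) 0 / 4096 ^ Suc j" 4096] by simp
  have "infinite_word s = prepend (s 0) 0 + (\<Sum>j. prepend (s (Suc j)) 0 / 4096 ^ Suc j)"
    unfolding infinite_word_def using suminf_split_head[OF sm] by simp
  also have "(\<Sum>j. prepend (s (Suc j)) 0 / 4096 ^ Suc j)
      = (\<Sum>j. prepend (s (Suc j)) 0 / 4096 ^ j / 4096)"
    by (simp add: mult.commute)
  also have "\<dots> = infinite_word (\<lambda>j. s (Suc j)) / 4096"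
    unfolding infinite_word_def by (rule suminf_divide[OF sm'])
  finally show "infinite_word s = prepend (s 0) (infinite_word (\<lambda>j. s (Suc j)))"
    using prepend_affine[of "s 0" "infinite_word (\<lambda>j. s (Suc j))"] block_simps(1)[OF assms[of 0]]
    by simp
qed

lemma takagi_infinite_word:
  assumes "\<And>j. s j \<in> blocks"
  shows "takagi (infinite_word s)
    = word_takagi (s 0) + takagi (infinite_word (\<lambda>j. s (Suc j))) / 4096"
proof -
  have "infinite_word (\<lambda>j. s (Suc j)) \<in> {0..<1}"
    by (rule infinite_word(2)) (rule assms)
  then have "infinite_word (\<lambda>j. s (Suc j)) \<in> {0..1}"
    by simp
  from takagi_prepend_block[OF this assms[of 0]] show ?thesis
    by (simp only: infinite_word(1)[of s, OF assms, symmetric])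
qed

text \<open>Equal block values cancel and leave the tail difference divided by 4096; iteration
  pushes the difference below every power of 1/4096. This allows infinitely many exchanges at
  once.\<close>

lemma takagi_infinite_word_cong:
  assumes "\<And>j. s j \<in> blocks" "\<And>j. s' j \<in> blocks" "\<And>j. word_takagi (s j) = word_takagi (s' j)"
  shows "takagi (infinite_word s) = takagi (infinite_word s')"
proof -
  have *: "\<bar>takagi (infinite_word s) - takagi (infinite_word s')\<bar> \<le> (1/4096) ^ n" for n
    using assms
  proof (induction n arbitrary: s s')
    case 0
    then show ?case
      using takagi_nonneg[of "infinite_word s"] takagi_le_1[of "infinite_word s"]
        takagi_nonneg[of "infinite_word s'"] takagi_le_1[of "infinite_word s'"] by simp
  next
    case (Suc n)
    have "takagi (infinite_word s) - takagi (infinite_word s')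
        = (takagi (infinite_word (\<lambda>j. s (Suc j))) - takagi (infinite_word (\<lambda>j. s' (Suc j)))) / 4096"
      using Suc.prems takagi_infinite_word[of s] takagi_infinite_word[of s'] by simp
    moreover have "\<bar>takagi (infinite_word (\<lambda>j. s (Suc j))) - takagi (infinite_word (\<lambda>j. s' (Suc j)))\<bar>
        \<le> (1/4096) ^ n"
      by (rule Suc.IH) (use Suc.prems in auto)
    ultimately show ?case by (simp only: abs_divide power_Suc) simp
  qed
  show ?thesis
  proof (rule ccontr)
    assume "\<not> ?thesis"
    then have "\<bar>takagi (infinite_word s) - takagi (infinite_word s')\<bar> > 0" by simp
    then obtain n where "(1/4096) ^ n < \<bar>takagi (infinite_word s) - takagi (infinite_word s')\<bar>"
      using real_arch_pow_inv[of "\<bar>takagi (infinite_word s) - takagi (infinite_word s')\<bar>" "1/4096"]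
      by auto
    then show False using *[of n] by simp
  qed
qed

text \<open>The tails contribute a difference of at most 1/4096, which cannot bridge
  \<open>blocks_takagi_gap\<close>; so the first values agree, and then the tails do.\<close>

lemma takagi_infinite_word_eqD:
  assumes "\<And>j. s j \<in> blocks" "\<And>j. s' j \<in> blocks"
    and "takagi (infinite_word s) = takagi (infinite_word s')"
  shows "word_takagi (s 0) = word_takagi (s' 0)"
    and "takagi (infinite_word (\<lambda>j. s (Suc j))) = takagi (infinite_word (\<lambda>j. s' (Suc j)))"
proof -
  let ?t = "infinite_word (\<lambda>j. s (Suc j))" and ?t' = "infinite_word (\<lambda>j. s' (Suc j))"
  have diff: "word_takagi (s 0) - word_takagi (s' 0) = (takagi ?t' - takagi ?t) / 4096"
    using takagi_infinite_word[of s, OF assms(1)] takagi_infinite_word[of s', OF assms(2)] assms(3)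
    by simp
  show eq: "word_takagi (s 0) = word_takagi (s' 0)"
  proof (rule ccontr)
    assume "word_takagi (s 0) \<noteq> word_takagi (s' 0)"
    then have "\<bar>word_takagi (s 0) - word_takagi (s' 0)\<bar> > 1/4096"
      using blocks_takagi_gap assms(1,2) by blast
    moreover have "\<bar>takagi ?t' - takagi ?t\<bar> \<le> 1"
      using takagi_nonneg[of ?t] takagi_le_1[of ?t] takagi_nonneg[of ?t'] takagi_le_1[of ?t']
      by linarith
    ultimately show False unfolding diff by (simp only: abs_divide) simp
  qed
  show "takagi ?t = takagi ?t'"
    using diff eq by simp
qed

lemma takagi_infinite_word_inj:
  assumes "\<And>j. s j \<in> blocks" "\<And>j. s' j \<in> blocks"
    and "takagi (infinite_word s) = takagi (infinite_word s')"
  shows "word_takagi (s j) = word_takagi (s' j)"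
  using assms
proof (induction j arbitrary: s s')
  case 0
  then show ?case by (rule takagi_infinite_word_eqD(1))
next
  case (Suc j)
  have "takagi (infinite_word (\<lambda>j. s (Suc j))) = takagi (infinite_word (\<lambda>j. s' (Suc j)))"
    using Suc.prems by (rule takagi_infinite_word_eqD(2))
  then show ?case
    using Suc.IH[of "\<lambda>j. s (Suc j)" "\<lambda>j. s' (Suc j)"] Suc.prems(1,2) by simp
qed

lemma local_equiv_infinite_wordD:
  assumes "\<And>j. s j \<in> blocks" "\<And>j. s' j \<in> blocks"
    and "(infinite_word s, infinite_word s') \<in> local_equiv"
  shows "s 0 = block_v \<longleftrightarrow> s' 0 = block_v"
    and "(infinite_word (\<lambda>j. s (Suc j)), infinite_word (\<lambda>j. s' (Suc j))) \<in> local_equiv"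
proof -
  have t: "infinite_word (\<lambda>j. s (Suc j)) \<in> {0..<1}"
    by (rule infinite_word(2)) (rule assms(1))
  have t': "infinite_word (\<lambda>j. s' (Suc j)) \<in> {0..<1}"
    by (rule infinite_word(2)) (rule assms(2))
  have "(prepend (s 0) (infinite_word (\<lambda>j. s (Suc j))),
      prepend (s' 0) (infinite_word (\<lambda>j. s' (Suc j)))) \<in> local_equiv"
    using assms(3) infinite_word(1)[of s, OF assms(1)] infinite_word(1)[of s', OF assms(2)] by simp
  from local_equiv_blockD[OF this assms(1) assms(2) t t']
  show "s 0 = block_v \<longleftrightarrow> s' 0 = block_v"
    "(infinite_word (\<lambda>j. s (Suc j)), infinite_word (\<lambda>j. s' (Suc j))) \<in> local_equiv" .
qed

lemma local_equiv_infinite_word: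
  assumes "\<And>j. s j \<in> blocks" "\<And>j. s' j \<in> blocks"
    and "(infinite_word s, infinite_word s') \<in> local_equiv"
  shows "s j = block_v \<longleftrightarrow> s' j = block_v"
  using assms
proof (induction j arbitrary: s s')
  case 0
  then show ?case by (rule local_equiv_infinite_wordD(1))
next
  case (Suc j)
  have "(infinite_word (\<lambda>j. s (Suc j)), infinite_word (\<lambda>j. s' (Suc j))) \<in> local_equiv"
    using Suc.prems by (rule local_equiv_infinite_wordD(2))
  then show ?case
    using Suc.IH[of "\<lambda>j. s (Suc j)" "\<lambda>j. s' (Suc j)"] Suc.prems(1,2) by simp
qed

section \<open>Continuum many ordinates with uncountably many local level sets\<close>

definition cut :: "real \<Rightarrow> nat \<Rightarrow> bool" where
  "cut r n \<longleftrightarrow> of_rat (from_nat n) < r"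

text \<open>A Dedekind cut read along an enumeration of the rationals: a rational between two reals
  tells them apart. Reals thus become sequences of binary choices between blocks.\<close>

lemma cut_inject:
  assumes "\<And>n. cut r n = cut r' n"
  shows "r = r'"
proof -
  have "\<exists>n. \<not> cut r n \<and> cut r' n" if less: "r < r'" for r r' :: real
  proof -
    obtain q where "r < of_rat q" "of_rat q < r'"
      using of_rat_dense[OF less] by blast
    then show ?thesis
      by (intro exI[of _ "to_nat q"]) (simp add: cut_def)
  qed
  then show ?thesis by (metis assms linorder_less_linear)
qed

text \<open>Even positions encode \<open>r\<close> by a choice that changes the ordinate, odd
  positions encode \<open>c\<close> by a choice that changes only the local level set.\<close>

definition two_parameter_word :: "real \<Rightarrow> real \<Rightarrow> nat \<Rightarrow> bool list" where
  "two_parameter_word r c j =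
    (if even j then (if cut r (j div 2) then block_u else block_w)
     else (if cut c (j div 2) then block_u else block_v))"

lemma S_inf_loc_uc_inj:
  assumes "0 \<le> a" "a < b" "b \<le> 2/3"
  obtains f :: "real \<Rightarrow> real" where "inj f" "range f \<subseteq> S_inf_loc_uc \<inter> {a<..<b}"
proof -
  obtain p where p: "word_balance p = 0"
    "\<And>z. z \<in> {0..<1} \<Longrightarrow> takagi (prepend p z) \<in> {a<..<b}"
    using takagi_small_interval[OF assms] by blast
  define x where "x r c = infinite_word (two_parameter_word r c)" for r c
  \<comment> \<open>The value \<open>c = 0\<close> is an arbitrary representative: by
    \<open>eq\<close> below the ordinate depends on \<open>r\<close> alone.\<close>
  define f where "f r = takagi (prepend p (x r 0))" for r
  have uv: "block_u \<noteq> block_v" "block_w \<noteq> block_v"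
    by (simp_all add: block_u_def block_v_def block_w_def)
  have bl: "two_parameter_word r c j \<in> blocks" for r c j
    by (simp add: two_parameter_word_def blocks_def)
  have x: "x r c \<in> {0..<1}" for r c
    unfolding x_def using bl by (rule infinite_word(2))
  then have x': "x r c \<in> {0..1}" for r c
    by (meson atLeastAtMost_iff atLeastLessThan_iff less_imp_le)
  have eq: "takagi (x r c) = takagi (x r 0)" for r c
    unfolding x_def using bl bl
    by (rule takagi_infinite_word_cong)
      (simp add: two_parameter_word_def word_takagi_block_u word_takagi_block_v)
  have "inj f"
  proof (rule injI)
    fix r r' assume "f r = f r'"
    then have "takagi (x r 0) = takagi (x r' 0)"
      using takagi_prepend_balanced[OF x' p(1)] by (simp add: f_def)
    then have *: "word_takagi (two_parameter_word r 0 j) = word_takagi (two_parameter_word r' 0 j)" for j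
      unfolding x_def by (rule takagi_infinite_word_inj[OF bl bl])
    \<comment> \<open>At the even position \<open>2 * n\<close> the values 69/128 and below 1/4
      reveal the bit.\<close>
    have "cut r n = cut r' n" for n
      using *[of "2 * n"] word_takagi_block_u word_takagi_block_w
      by (simp add: two_parameter_word_def split: if_splits)
    then show "r = r'" by (rule cut_inject)
  qed
  moreover have "f r \<in> S_inf_loc_uc \<inter> {a<..<b}" for r
  proof -
    have "(UNIV :: real set) \<lesssim> local_level_sets_in (f r)"
    proof (rule local_level_sets_lepoll[where f = "\<lambda>c. prepend p (x r c)"])
      fix c :: real
      show "prepend p (x r c) \<in> takagi_level (f r)"
        using takagi_prepend_balanced[OF x' p(1)] eq[of r c] prepend_in[OF x']
        by (simp add: takagi_level_def f_def)
    next
      fix c c' :: real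
      assume "(prepend p (x r c), prepend p (x r c')) \<in> local_equiv"
      then have "(x r c, x r c') \<in> local_equiv"
        by (rule local_equiv_prependD) (use p(1) x in auto)
      then have *: "two_parameter_word r c j = block_v \<longleftrightarrow> two_parameter_word r c' j = block_v" for j
        unfolding x_def by (rule local_equiv_infinite_word[OF bl bl])
      \<comment> \<open>At the odd position the occurrence of \<open>block_v\<close> reveals the
        bit.\<close>
      have "cut c n = cut c' n" for n
        using *[of "Suc (2 * n)"] uv by (simp add: two_parameter_word_def split: if_splits)
      then show "c = c'" by (rule cut_inject)
    qed
    then have "uncountable (local_level_sets_in (f r))"
      using countable_lepoll uncountable_UNIV_real by blast
    moreover have "f r \<in> {a<..<b}"
      unfolding f_def by (rule p(2)[OF x])
    ultimately show ?thesis
      using assms by (simp add: S_inf_loc_uc_def)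
  qed
  ultimately show ?thesis using that by blast
qed

theorem theorem4p9:
  shows "residual_in (top_of_set {0..2/3}) S_inf_loc \<and>
    (top_of_set {0..2/3}) closure_of S_inf_loc_uc = {0..2/3} \<and>
    (\<forall>I :: real set. is_interval I \<longrightarrow> I \<subseteq> {0..2/3} \<longrightarrow> (\<exists>a\<in>I. \<exists>b\<in>I. a < b) \<longrightarrow>
       S_inf_loc_uc \<inter> I \<approx> (UNIV :: real set))"
proof (intro conjI allI impI)
  show "residual_in (top_of_set {0..2/3}) S_inf_loc"
    by (rule residual_S_inf_loc)
next
  have "\<exists>z. z \<in> S_inf_loc_uc \<and> z \<in> U"
    if U: "y \<in> U" "openin (top_of_set {0..2/3}) U" for y and U :: "real set"
  proof -
    obtain a b where ab: "0 \<le> a" "a < b" "b \<le> 2/3" "{a<..<b} \<subseteq> U"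
      using openin_Icc_contains_Ioo[OF U(2)] U(1) by auto
    obtain f :: "real \<Rightarrow> real" where "range f \<subseteq> S_inf_loc_uc \<inter> {a<..<b}"
      using S_inf_loc_uc_inj[OF ab(1-3)] by blast
    then show ?thesis using ab(4) by blast
  qed
  then show "(top_of_set {0..2/3}) closure_of S_inf_loc_uc = {0..2/3}"
    unfolding closure_of_def by auto
next
  fix I :: "real set"
  assume I: "is_interval I" "I \<subseteq> {0..2/3}" "\<exists>a\<in>I. \<exists>b\<in>I. a < b"
  obtain a b where ab: "a \<in> I" "b \<in> I" "a < b" using I(3) by blast
  have sub: "{a<..<b} \<subseteq> I"
  proof
    fix x assume "x \<in> {a<..<b}"
    then show "x \<in> I"
      using mem_is_interval_1_I[OF I(1) ab(1,2), of x] by simp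
  qed
  have "0 \<le> a" "b \<le> 2/3" using ab I(2) by auto
  then obtain f :: "real \<Rightarrow> real" where f: "inj f" "range f \<subseteq> S_inf_loc_uc \<inter> {a<..<b}"
    using S_inf_loc_uc_inj ab(3) by blast
  then have "(UNIV :: real set) \<lesssim> S_inf_loc_uc \<inter> I"
    unfolding lepoll_def using sub by blast
  \<comment> \<open>The upper bound is inclusion in the reals; Schroeder-Bernstein combines the
    two.\<close>
  then show "S_inf_loc_uc \<inter> I \<approx> (UNIV :: real set)"
    by (simp add: lepoll_antisym subset_imp_lepoll)
qed

end
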